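(* Suppose that $(X,d,\mu)$ is an unbounded metric measure space with $\sup\{\mu(B(x,1)):x\in X\}<\infty$. Assume that $g(r):=\inf\{\mu(B(x,r)):x\in X\}>0$ for all $r\in(0,1)$. Let $H$ be a compact subgroup of $\mathrm{Iso}_\mu(X,d)$. Let $s,p,\beta\in\mathcal{P}_b(X)$, $q\in\mathcal{P}(X)$ be such that either $s^+<1$ and $q^-<\infty$, or $s^+\le1$ and $q^-=\infty$. Suppose that at least one of the following compact embeddings holds: $$M^{s(\cdot),H}_{p(\cdot),q(\cdot)}(X,d,\mu)\hookrightarrow\hookrightarrow L^{\beta(\cdot)}(X,\mu),\qquad N^{s(\cdot),H}_{p(\cdot),q(\cdot)}(X,d,\mu)\hookrightarrow\hookrightarrow L^{\beta(\cdot)}(X,\mu).$$ Then, for every $x_0\in X$ and $r\in(0,1/3)$, $$\lim_{R\to\infty}\ \inf_{x\in X\setminus B(x_0,R)}M_H(x,r)=\infty.$$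
   Context: A metric measure space $(X,d,\mu)$ is a metric space $(X,d)$ with a Borel measure $\mu$ such that $0<\mu(B(x,r))<\infty$ for every open ball $B(x,r)$, $x\in X$, $r\in(0,\infty)$ (in particular $X$ is separable). Exponents: for measurable $p$ on $X$, $p^+=\operatorname{ess\,sup}_X p$, $p^-=\operatorname{ess\,inf}_X p$. $\mathcal{P}(X)$ is the set of measurable $p:X\to(0,\infty]$ with $p^->0$; $\mathcal{P}_b(X)=\mathcal{P}(X)\cap L^\infty(X,\mu)$. Isometries: $\mathrm{Iso}_\mu(X,d)$ is the group of isometries $\varphi$ of $(X,d)$ (onto itself) with $\varphi_\#\mu=\mu$, where $\varphi_\#\mu(A)=\mu(\varphi^{-1}(A))$ for Borel $A$; compactness of subgroups refers to the usual compact-open topology (equivalently, pointwise convergence). For $H\subseteq\mathrm{Iso}_\mu(X,d)$, $H(x)=\{h(x):h\in H\}$ and $M_H(x,r)=\sup\{\#A: A\subseteq H(x),\ B(\xi,r)\cap B(\eta,r)=\emptyset\text{ for all distinct }\xi,\eta\in A\}$. Lebesgue spaces: for $p\in\mathcal{P}_b(X)$ let $\rho_{p(\cdot)}(u)=\int_X|u(x)|^{p(x)}\,d\mu(x)$. $L^{p(\cdot)}(X,\mu)$ is the space of measurable $u$ with $\rho_{p(\cdot)}(\lambda u)<\infty$ for some $\lambda>0$, with quasi-norm $\|u\|_{L^{p(\cdot)}}=\inf\{\lambda>0:\rho_{p(\cdot)}(u/\lambda)\le1\}$. Mixed spaces ($p\in\mathcal{P}_b(X)$, $q\in\mathcal{P}(X)$):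 for sequences $\{u_k\}_{k\in\mathbb{Z}}$ of measurable functions, $\|\{u_k\}\|_{L^{p(\cdot)}(\ell^{q(\cdot)})}=\big\|\,\|\{u_k(\cdot)\}_k\|_{\ell^{q(\cdot)}}\big\|_{L^{p(\cdot)}}$ (pointwise $\ell^{q(x)}(\mathbb{Z})$ quasi-norm, supremum if $q(x)=\infty$). Let $\rho_{\ell^{q(\cdot)}(L^{p(\cdot)})}(\{u_k\})=\sum_{k\in\mathbb{Z}}\inf\{\lambda_k>0:\rho_{p(\cdot)}(u_k/\lambda_k^{1/q(\cdot)})\le1\}$ (with $\lambda^{1/\infty}=1$) and $\|\{u_k\}\|_{\ell^{q(\cdot)}(L^{p(\cdot)})}=\inf\{m>0:\rho_{\ell^{q(\cdot)}(L^{p(\cdot)})}(\{u_k\}/m)\le1\}$. Gradients: let $s\in\mathcal{P}_b(X)$ and $u:X\to\overline{\mathbb{R}}$ be measurable and finite a.e. A sequence $\{g_k\}_{k\in\mathbb{Z}}$ of non-negative measurable functions is a vector $s(\cdot)$-gradient of $u$ (written $\{g_k\}\in\mathbb{D}^{s(\cdot)}(u)$) if there is a $\mu$-null set $N_u$ such that $|u(x)-u(y)|\le d(x,y)^{s(x)}g_k(x)+d(x,y)^{s(y)}g_k(y)$ for all $k\in\mathbb{Z}$ and all $x,y\in X\setminus N_u$ with $2^{-k-1}\le d(x,y)<2^{-k}$. Function spaces: $\|u\|_{\dot M^{s(\cdot)}_{p(\cdot),q(\cdot)}}=\inf_{g\in\mathbb{D}^{s(\cdot)}(u)}\|g\|_{L^{p(\cdot)}(\ell^{q(\cdot)})}$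 and $\|u\|_{\dot N^{s(\cdot)}_{p(\cdot),q(\cdot)}}=\inf_{g\in\mathbb{D}^{s(\cdot)}(u)}\|g\|_{\ell^{q(\cdot)}(L^{p(\cdot)})}$. For $A\in\{M,N\}$, $A^{s(\cdot)}_{p(\cdot),q(\cdot)}(X,d,\mu)$ is the space of $u\in L^{p(\cdot)}(X,\mu)$ with $\|u\|_{\dot A^{s(\cdot)}_{p(\cdot),q(\cdot)}}<\infty$, with quasi-norm $\|u\|_{L^{p(\cdot)}}+\|u\|_{\dot A^{s(\cdot)}_{p(\cdot),q(\cdot)}}$; $A^{s(\cdot),H}_{p(\cdot),q(\cdot)}(X,d,\mu)$ is its subspace of $u$ with $u\circ\varphi=u$ for all $\varphi\in H$. $Y\hookrightarrow\hookrightarrow Z$ (compact embedding) means $Y\subseteq Z$ with continuous inclusion mapping bounded subsets of $Y$ to totally bounded subsets of $Z$. *)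

theory Defs
  imports "HOL-Probability.Essential_Supremum" "HOL-Algebra.Group"
begin

section \<open>Metric measure spaces\<close>

definition metric_measure_space :: "'a::metric_space measure \<Rightarrow> bool" where
  "metric_measure_space M \<longleftrightarrow> sets M = sets borel \<and>
     (\<forall>x r. 0 < r \<longrightarrow> 0 < emeasure M (ball x r) \<and> emeasure M (ball x r) < \<infinity>)"


section \<open>Variable exponents\<close>

text \<open>The library provides the essential supremum only.\<close>

definition essinf :: "'a measure \<Rightarrow> ('a \<Rightarrow> ennreal) \<Rightarrow> ennreal" where
  "essinf M f = Sup {z. AE x in M. z \<le> f x}"

definition exponents :: "'a measure \<Rightarrow> ('a \<Rightarrow> ennreal) set" where
  "exponents M = {p \<in> borel_measurable M. (\<forall>x\<in>space M. 0 < p x) \<and> 0 < essinf M p}"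

definition bounded_exponents :: "'a measure \<Rightarrow> ('a \<Rightarrow> ennreal) set" where
  "bounded_exponents M = {p \<in> exponents M. esssup M p < \<infinity>}"

text \<open>Powers \<open>t\<^sup>a\<close> of extended non-negative reals. In the definitions below an infinite exponent
  occurs only through a bounded exponent, hence on a null set, so the value chosen in that case
  is immaterial; a zero exponent occurs only as \<open>1 / q x\<close> with \<open>q x = \<infinity>\<close>, for a positive finite
  base.\<close>

definition enn_powr :: "ennreal \<Rightarrow> ennreal \<Rightarrow> ennreal" where
  "enn_powr t a =
     (if a = \<infinity> then (if t < 1 then 0 else if t = 1 then 1 else \<infinity>)
      else if t = \<infinity> then (if a = 0 then 1 else \<infinity>)
      else ennreal (enn2real t powr enn2real a))"


section \<open>Lebesgue spaces with variable exponent\<close>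

text \<open>Modulars and quasi-norms are defined for functions with values in \<open>[0, \<infinity>]\<close> and applied to
  an extended real function \<open>u\<close> through its modulus. Elements of the function spaces are
  represented by Borel functions, so that equality of elements means equality almost everywhere.\<close>

definition modulus :: "('a \<Rightarrow> ereal) \<Rightarrow> 'a \<Rightarrow> ennreal" where
  "modulus u = (\<lambda>x. e2ennreal \<bar>u x\<bar>)"

definition modular :: "'a measure \<Rightarrow> ('a \<Rightarrow> ennreal) \<Rightarrow> ('a \<Rightarrow> ennreal) \<Rightarrow> ennreal" where
  "modular M p f = (\<integral>\<^sup>+x. enn_powr (f x) (p x) \<partial>M)"

definition Lp_qnorm :: "'a measure \<Rightarrow> ('a \<Rightarrow> ennreal) \<Rightarrow> ('a \<Rightarrow> ennreal) \<Rightarrow> ennreal" where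
  "Lp_qnorm M p f = Inf {ennreal l | l. 0 < l \<and> modular M p (\<lambda>x. f x / ennreal l) \<le> 1}"

definition Lp_space :: "'a measure \<Rightarrow> ('a \<Rightarrow> ennreal) \<Rightarrow> ('a \<Rightarrow> ereal) set" where
  "Lp_space M p = {u \<in> borel_measurable M.
     \<exists>l>0. modular M p (\<lambda>x. ennreal l * modulus u x) < \<infinity>}"

abbreviation Lp_norm :: "'a measure \<Rightarrow> ('a \<Rightarrow> ennreal) \<Rightarrow> ('a \<Rightarrow> ereal) \<Rightarrow> ennreal" where
  "Lp_norm M p u \<equiv> Lp_qnorm M p (modulus u)"


section \<open>Mixed spaces\<close>

definition lq_qnorm :: "ennreal \<Rightarrow> (int \<Rightarrow> ennreal) \<Rightarrow> ennreal" where
  "lq_qnorm q c = (if q = \<infinity> then (SUP k. c k)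
     else enn_powr (\<Sum>\<^sub>\<infinity>k. enn_powr (c k) q) (inverse q))"

definition Lp_lq_qnorm ::
  "'a measure \<Rightarrow> ('a \<Rightarrow> ennreal) \<Rightarrow> ('a \<Rightarrow> ennreal) \<Rightarrow> (int \<Rightarrow> 'a \<Rightarrow> ennreal) \<Rightarrow> ennreal" where
  "Lp_lq_qnorm M p q g = Lp_qnorm M p (\<lambda>x. lq_qnorm (q x) (\<lambda>k. g k x))"

definition lq_Lp_modular ::
  "'a measure \<Rightarrow> ('a \<Rightarrow> ennreal) \<Rightarrow> ('a \<Rightarrow> ennreal) \<Rightarrow> (int \<Rightarrow> 'a \<Rightarrow> ennreal) \<Rightarrow> ennreal" where
  "lq_Lp_modular M p q g = (\<Sum>\<^sub>\<infinity>k.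
     Inf {ennreal l | l. 0 < l \<and>
       modular M p (\<lambda>x. g k x / enn_powr (ennreal l) (inverse (q x))) \<le> 1})"

definition lq_Lp_qnorm ::
  "'a measure \<Rightarrow> ('a \<Rightarrow> ennreal) \<Rightarrow> ('a \<Rightarrow> ennreal) \<Rightarrow> (int \<Rightarrow> 'a \<Rightarrow> ennreal) \<Rightarrow> ennreal" where
  "lq_Lp_qnorm M p q g =
     Inf {ennreal m | m. 0 < m \<and> lq_Lp_modular M p q (\<lambda>k x. g k x / ennreal m) \<le> 1}"


section \<open>Vector gradients and function spaces\<close>

text \<open>\<open>u\<close> is meant to be measurable and finite almost everywhere. The convention
  \<open>\<infinity> - \<infinity> = \<infinity>\<close> of the library is harmless, since the points where \<open>u\<close> is infinite can be put
  into the exceptional null set.\<close>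

definition vector_gradients ::
  "'a::metric_space measure \<Rightarrow> ('a \<Rightarrow> ennreal) \<Rightarrow> ('a \<Rightarrow> ereal) \<Rightarrow> (int \<Rightarrow> 'a \<Rightarrow> ennreal) set" where
  "vector_gradients M s u = {g. (\<forall>k. g k \<in> borel_measurable M) \<and>
     (\<exists>N\<in>null_sets M. \<forall>k. \<forall>x\<in>- N. \<forall>y\<in>- N.
        2 powi (- k - 1) \<le> dist x y \<and> dist x y < 2 powi (- k) \<longrightarrow>
        e2ennreal \<bar>u x - u y\<bar> \<le>
          enn_powr (ennreal (dist x y)) (s x) * g k x + enn_powr (ennreal (dist x y)) (s y) * g k y)}"

definition M_seminorm where
  "M_seminorm M s p q u = (INF g\<in>vector_gradients M s u. Lp_lq_qnorm M p q g)"

definition N_seminorm where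
  "N_seminorm M s p q u = (INF g\<in>vector_gradients M s u. lq_Lp_qnorm M p q g)"

definition M_space where
  "M_space M s p q = {u \<in> Lp_space M p. M_seminorm M s p q u < \<infinity>}"

definition N_space where
  "N_space M s p q = {u \<in> Lp_space M p. N_seminorm M s p q u < \<infinity>}"

definition M_norm where
  "M_norm M s p q u = Lp_norm M p u + M_seminorm M s p q u"

definition N_norm where
  "N_norm M s p q u = Lp_norm M p u + N_seminorm M s p q u"


section \<open>Measure preserving isometries\<close>

definition Iso :: "'a::metric_space measure \<Rightarrow> ('a \<Rightarrow> 'a) set" where
  "Iso M = {\<phi>. bij \<phi> \<and> (\<forall>x y. dist (\<phi> x) (\<phi> y) = dist x y) \<and> distr M M \<phi> = M}"

definition Iso_group :: "'a::metric_space measure \<Rightarrow> ('a \<Rightarrow> 'a) monoid" where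
  "Iso_group M = \<lparr>carrier = Iso M, monoid.mult = (\<circ>), one = id\<rparr>"

text \<open>Subsets of \<open>Iso M\<close> carry the subspace topology of the following one.\<close>

definition compact_open_topology ::
  "('a::topological_space \<Rightarrow> 'b::topological_space) topology" where
  "compact_open_topology =
     topology_generated_by {{f. f ` K \<subseteq> U} | K U. compact K \<and> open U}"

definition invariant_part ::
  "'a measure \<Rightarrow> ('a \<Rightarrow> 'a) set \<Rightarrow> ('a \<Rightarrow> ereal) set \<Rightarrow> ('a \<Rightarrow> ereal) set" where
  "invariant_part M H Y = {u \<in> Y. \<forall>\<phi>\<in>H. AE x in M. u (\<phi> x) = u x}"

definition orbit_of :: "('a \<Rightarrow> 'a) set \<Rightarrow> 'a \<Rightarrow> 'a set" where
  "orbit_of H x = {h x | h. h \<in> H}"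

definition ecard :: "'a set \<Rightarrow> enat" where
  "ecard A = (if finite A then enat (card A) else \<infinity>)"

definition orbit_packing :: "('a::metric_space \<Rightarrow> 'a) set \<Rightarrow> 'a \<Rightarrow> real \<Rightarrow> enat" where
  "orbit_packing H x r = Sup {ecard A | A. A \<subseteq> orbit_of H x \<and>
     (\<forall>\<xi>\<in>A. \<forall>\<eta>\<in>A. \<xi> \<noteq> \<eta> \<longrightarrow> ball \<xi> r \<inter> ball \<eta> r = {})}"


section \<open>Compact embeddings\<close>

text \<open>Quasi-normed function spaces are given by their underlying set and their quasi-norm.
  Differences of representatives are well defined almost everywhere.\<close>

definition continuous_inclusion ::
  "('a \<Rightarrow> ereal) set \<Rightarrow> (('a \<Rightarrow> ereal) \<Rightarrow> ennreal) \<Rightarrow> (('a \<Rightarrow> ereal) \<Rightarrow> ennreal) \<Rightarrow> bool" where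
  "continuous_inclusion Y nY nZ \<longleftrightarrow>
     (\<forall>u\<in>Y. \<forall>e>0. \<exists>d>0. \<forall>v\<in>Y. nY (\<lambda>x. v x - u x) < d \<longrightarrow> nZ (\<lambda>x. v x - u x) < e)"

definition qnorm_bounded ::
  "(('a \<Rightarrow> ereal) \<Rightarrow> ennreal) \<Rightarrow> ('a \<Rightarrow> ereal) set \<Rightarrow> bool" where
  "qnorm_bounded nY B \<longleftrightarrow> (\<exists>C<\<infinity>. \<forall>u\<in>B. nY u \<le> C)"

definition qnorm_totally_bounded ::
  "('a \<Rightarrow> ereal) set \<Rightarrow> (('a \<Rightarrow> ereal) \<Rightarrow> ennreal) \<Rightarrow> ('a \<Rightarrow> ereal) set \<Rightarrow> bool" where
  "qnorm_totally_bounded Z nZ B \<longleftrightarrow>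
     (\<forall>e>0. \<exists>F. finite F \<and> F \<subseteq> Z \<and> (\<forall>u\<in>B. \<exists>f\<in>F. nZ (\<lambda>x. u x - f x) < e))"

definition compact_embedding ::
  "('a \<Rightarrow> ereal) set \<Rightarrow> (('a \<Rightarrow> ereal) \<Rightarrow> ennreal) \<Rightarrow>
   ('a \<Rightarrow> ereal) set \<Rightarrow> (('a \<Rightarrow> ereal) \<Rightarrow> ennreal) \<Rightarrow> bool" where
  "compact_embedding Y nY Z nZ \<longleftrightarrow> Y \<subseteq> Z \<and> continuous_inclusion Y nY nZ \<and>
     (\<forall>B\<subseteq>Y. qnorm_bounded nY B \<longrightarrow> qnorm_totally_bounded Z nZ B)"

end

theory Submission
  imports Defs
begin

text \<open>
  The proof is by contraposition. If the limit is not infinite for some \<open>r\<close>, then for some \<open>K\<close> the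
  set \<open>P\<close> of all points whose orbit has no \<open>r\<close>-packing with more than \<open>K\<close> points is unbounded. For
  \<open>x\<close> in \<open>P\<close> let \<open>u\<^sub>x\<close> be the tent function \<open>max 0 (1 - dist(y, H x) / r)\<close>. It is \<open>H\<close>-invariant,
  because \<open>H\<close> is a group of isometries, and the balls of radius \<open>2 r\<close> around a maximal packing cover
  the orbit. So its support lies in \<open>K\<close> balls of radius \<open>3 r \<le> 1\<close>, whose total measure is bounded
  independently of \<open>x\<close> (\<open>near_orbit_covered_by_unit_balls\<close>).

  The family of all \<open>u\<^sub>x\<close> is bounded in both function spaces (\<open>Lipschitz_bump_norm_bound\<close>). Indeed a
  function with values in \<open>[0, 1]\<close> and Lipschitz constant \<open>1 / r\<close> that vanishes off \<open>S\<close> has the vector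
  gradient \<open>g\<^sub>k = c\<^sub>k 1\<^sub>S\<close> with \<open>c\<^sub>k = 2 powr (- \<eta> |k|) / r\<close>, as soon as \<open>\<eta> \<le> s \<le> 1 - \<eta>\<close>. If
  \<open>s\<^sup>+ < 1\<close>, one can take \<open>\<eta> > 0\<close>, and then \<open>c\<^sub>k\<close> decays geometrically on both sides; if \<open>s\<^sup>+ \<le> 1\<close>
  only, one takes \<open>\<eta> = 0\<close>, and \<open>c\<^sub>k\<close> is bounded, which suffices for \<open>q = \<infinity>\<close>. Both cases, and
  both orders of the mixed norms, are handled through one condition: there are positive weights
  \<open>w\<^sub>k\<close> of total mass at most \<open>1\<close> with \<open>c\<^sub>k \<le> E w\<^sub>k powr (1 / q x)\<close> for almost every \<open>x\<close>
  (\<open>dyadic_weights_dominate\<close>, \<open>mixed_qnorms_le_of_dominated\<close>).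

  On the other hand the family is not totally bounded in \<open>L\<^sup>\<beta>\<close>
  (\<open>escaping_bumps_not_totally_bounded\<close>): a finite net would have an element \<open>f\<close> that is close to
  \<open>u\<^sub>x\<close> for an unbounded set of \<open>x\<close>, hence close to \<open>u\<^sub>x\<close> and \<open>u\<^sub>y\<close> for some \<open>x\<close> far from the support of
  \<open>u\<^sub>y\<close>. On the ball of radius \<open>r / 2\<close> around \<open>x\<close> one has \<open>u\<^sub>x \<ge> 1/2\<close> and \<open>u\<^sub>y = 0\<close>, so at each point
  of this ball \<open>f\<close> misses one of them by \<open>1/4\<close>. But such balls have measure bounded below.
\<close>

section \<open>Powers and exponents\<close>

lemma enn_powr_ennreal:
  assumes "0 \<le> t" "a \<noteq> \<infinity>"
  shows "enn_powr (ennreal t) a = ennreal (t powr enn2real a)"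
  using assms by (simp add: enn_powr_def)

text \<open>Monotonicity in the base survives all conventions at infinite arguments; it is what allows
  modulars to be compared pointwise almost everywhere.\<close>

lemma enn_powr_mono:
  assumes "t \<le> t'"
  shows "enn_powr t a \<le> enn_powr t' a"
proof (cases "a = \<infinity>")
  case True
  then show ?thesis using assms
    by (auto simp: enn_powr_def)
next
  case False
  show ?thesis
  proof (cases "t' = \<infinity>")
    case True
    then show ?thesis
      using \<open>a \<noteq> \<infinity>\<close> by (auto simp: enn_powr_def powr_def)
  next
    case False
    then have "t \<noteq> \<infinity>" using assms by (auto simp: top_unique)
    then have "enn2real t \<le> enn2real t'"
      using False assms by (intro enn2real_mono) (auto simp: less_top)
    then show ?thesis
      using \<open>a \<noteq> \<infinity>\<close> \<open>t \<noteq> \<infinity>\<close> False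
      by (auto simp: enn_powr_def intro!: ennreal_leI powr_mono2)
  qed
qed

lemma le_enn2real_of_ennreal_le:
  assumes "ennreal a \<le> t" "t \<noteq> \<infinity>"
  shows "a \<le> enn2real t"
  using assms by (cases t) (auto simp: ennreal_le_iff)

lemma AE_lower_bound_of_essinf_pos:
  assumes "0 < essinf M f"
  obtains a :: real where "0 < a" "AE x in M. ennreal a \<le> f x"
proof -
  obtain z where z: "AE x in M. z \<le> f x" "0 < z"
    using assms unfolding essinf_def less_Sup_iff by auto
  define a where "a = enn2real (min z 1)"
  have fin: "min z 1 \<noteq> \<infinity>" using min.cobounded2[of z 1] by (metis ennreal_one_less_top infinity_ennreal_def leD)
  have "ennreal a = min z 1"
    using fin unfolding a_def by (simp add: less_top)
  then have "ennreal a \<le> z" "ennreal a > 0"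
    using z(2) by auto
  then show ?thesis
    using z(1) by (intro that[of a]) (auto simp: ennreal_le_1 elim!: eventually_mono)
qed

text \<open>The essential infimum is a supremum of almost sure lower bounds, so an infinite one supplies
  every natural number as such a bound, and countably many null sets can be discarded.\<close>

lemma AE_infinite_of_essinf_infinite:
  assumes "essinf M f = \<infinity>"
  shows "AE x in M. f x = \<infinity>"
proof -
  have "AE x in M. of_nat n \<le> f x" for n :: nat
  proof -
    have "of_nat n < essinf M f" using assms by (simp add: of_nat_less_top)
    then obtain z where "AE x in M. z \<le> f x" "of_nat n < z"
      unfolding essinf_def less_Sup_iff by auto
    then show ?thesis by (auto elim!: eventually_mono)
  qed
  then have "AE x in M. \<forall>n::nat. of_nat n \<le> f x" by (simp add: AE_all_countable)
  then show ?thesis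
    by (rule eventually_mono) (metis ennreal_Ex_less_of_nat infinity_ennreal_def less_top linorder_not_le)
qed

text \<open>The positive lower bound turns a small base into a small power and a large base into a large
  power, uniformly in the point.\<close>

lemma bounded_exponent_AE:
  assumes "p \<in> bounded_exponents M"
  obtains a :: real where "0 < a" "AE x in M. ennreal a \<le> p x \<and> p x < \<infinity>"
proof -
  have pos: "0 < essinf M p" and fin: "esssup M p < \<infinity>"
    using assms by (auto simp: bounded_exponents_def exponents_def)
  obtain a :: real where a: "0 < a" "AE x in M. ennreal a \<le> p x"
    using AE_lower_bound_of_essinf_pos[OF pos] .
  moreover have "AE x in M. p x < \<infinity>"
    using esssup_AE[of p M] by eventually_elim (use fin in order)
  ultimately show ?thesis by (intro that[of a]) (auto elim: eventually_elim2)
qed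

section \<open>Modulars\<close>

text \<open>For a base in \<open>[0, 1]\<close> the smallest exponent gives the largest power.\<close>

lemma modular_le_of_small:
  assumes p: "AE x in M. ennreal a \<le> p x \<and> p x < \<infinity>" and "0 < a"
    and e: "0 \<le> e" "e \<le> 1" and S: "S \<in> sets M"
    and f: "AE x in M. f x \<le> ennreal e * indicator S x"
  shows "modular M p f \<le> ennreal (e powr a) * emeasure M S"
proof -
  have "modular M p f \<le> (\<integral>\<^sup>+x. ennreal (e powr a) * indicator S x \<partial>M)"
    unfolding modular_def
  proof (rule nn_integral_mono_AE, use p f in eventually_elim)
    case (elim x)
    then have px: "p x \<noteq> \<infinity>" "a \<le> enn2real (p x)"
      by (auto intro: le_enn2real_of_ennreal_le)
    have "enn_powr (f x) (p x) \<le> enn_powr (ennreal (e * indicator S x)) (p x)"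
      using elim e by (intro enn_powr_mono) (auto simp: ennreal_mult indicator_def)
    also have "\<dots> = ennreal ((e * indicator S x) powr enn2real (p x))"
      using px e by (intro enn_powr_ennreal) auto
    also have "\<dots> \<le> ennreal (e powr a) * indicator S x"
      using e px by (auto simp: indicator_def intro!: ennreal_leI powr_mono')
    finally show ?case .
  qed
  also have "\<dots> = ennreal (e powr a) * emeasure M S"
    using S by (rule nn_integral_cmult_indicator)
  finally show ?thesis .
qed

text \<open>The factor \<open>V powr (- 1 / a)\<close> is chosen so that its power with the exponent \<open>a\<close> compensates
  the measure \<open>V\<close> exactly.\<close>

lemma modular_le_one_of_scaled:
  assumes p: "AE x in M. ennreal a \<le> p x \<and> p x < \<infinity>" and "0 < a"
    and S: "S \<in> sets M" "emeasure M S \<le> ennreal V" "1 \<le> V"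
    and f: "AE x in M. f x \<le> ennreal (V powr (- 1 / a)) * indicator S x"
  shows "modular M p f \<le> 1"
proof -
  let ?e = "V powr (- 1 / a)"
  have "?e \<le> V powr 0"
    using S \<open>0 < a\<close> by (intro powr_mono) auto
  then have "?e \<le> 1" using S by simp
  then have "modular M p f \<le> ennreal (?e powr a) * emeasure M S"
    by (intro modular_le_of_small[OF p \<open>0 < a\<close> _ _ S(1) f]) auto
  also have "\<dots> \<le> ennreal (?e powr a) * ennreal V"
    using S by (intro mult_left_mono) auto
  also have "\<dots> = ennreal (V powr (-1) * V)"
    using \<open>0 < a\<close> S by (simp add: powr_powr ennreal_mult[symmetric])
  also have "V powr (-1) * V = 1"
    using S by (simp add: powr_minus)
  finally show ?thesis by simp
qed

lemma divide_le_of_le_mult_ennreal: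
  assumes "f \<le> ennreal E * c" "0 < E" "0 < l"
  shows "f / ennreal (E * l) \<le> ennreal (1 / l) * c"
proof -
  have "f / ennreal (E * l) \<le> (ennreal E * c) / ennreal (E * l)"
    using assms by (intro divide_right_mono_ennreal) auto
  also have "\<dots> = c * (ennreal E / ennreal (E * l))"
    by (simp add: ennreal_times_divide mult.commute)
  also have "ennreal E / ennreal (E * l) = ennreal (1 / l)"
    using assms by (simp add: divide_ennreal)
  finally show ?thesis by (simp only: mult.commute)
qed

lemma Lp_qnorm_le_of_bounded_on:
  assumes p: "AE x in M. ennreal a \<le> p x \<and> p x < \<infinity>" and "0 < a"
    and S: "S \<in> sets M" "emeasure M S \<le> ennreal V" "1 \<le> V"
    and "0 < E" and f: "AE x in M. f x \<le> ennreal E * indicator S x"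
  shows "Lp_qnorm M p f \<le> ennreal (E * V powr (1 / a))"
proof -
  let ?l = "V powr (1 / a)"
  have inv: "1 / ?l = V powr (- 1 / a)" by (simp add: powr_minus divide_inverse)
  have "modular M p (\<lambda>x. f x / ennreal (E * ?l)) \<le> 1"
  proof (rule modular_le_one_of_scaled[OF p \<open>0 < a\<close> S])
    show "AE x in M. f x / ennreal (E * ?l) \<le> ennreal (V powr (- 1 / a)) * indicator S x"
      using f by eventually_elim
        (use divide_le_of_le_mult_ennreal[of _ E _ ?l] S \<open>0 < E\<close> inv in auto)
  qed
  moreover have "0 < E * ?l" using S \<open>0 < E\<close> by simp
  ultimately show ?thesis unfolding Lp_qnorm_def by (intro Inf_lower) blast
qed

text \<open>Chebyshev's inequality. A quasi-norm below \<open>d\<close> gives a modular of \<open>v / l\<close> at most \<open>1\<close> for some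
  \<open>l < d\<close>, and on the set in question the integrand is at least \<open>(1 / (4 d)) powr a\<close>, because the base
  is at least \<open>1 / (4 d) \<ge> 1\<close>.\<close>

lemma emeasure_le_of_Lp_norm_less:
  assumes p: "AE x in M. ennreal a \<le> p x \<and> p x < \<infinity>" and "0 < a"
    and v[measurable]: "v \<in> borel_measurable M"
    and d: "0 < d" "d \<le> 1 / 4" and less: "Lp_norm M p v < ennreal d"
  shows "emeasure M {x \<in> space M. 1 / 4 \<le> modulus v x} \<le> ennreal ((4 * d) powr a)"
proof -
  let ?A = "{x \<in> space M. 1 / 4 \<le> modulus v x}"
  have [measurable]: "modulus v \<in> borel_measurable M"
    unfolding modulus_def by measurable
  obtain l where l: "0 < l" "l < d" "modular M p (\<lambda>x. modulus v x / ennreal l) \<le> 1"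
    using less d unfolding Lp_qnorm_def Inf_less_iff by (auto simp: ennreal_less_iff)
  let ?c = "(1 / (4 * d)) powr a"
  have "ennreal ?c * emeasure M ?A = (\<integral>\<^sup>+x. ennreal ?c * indicator ?A x \<partial>M)"
    by (rule nn_integral_cmult_indicator[symmetric]) measurable
  also have "\<dots> \<le> modular M p (\<lambda>x. modulus v x / ennreal l)"
    unfolding modular_def
  proof (rule nn_integral_mono_AE, use p in eventually_elim)
    case (elim x)
    then have px: "p x \<noteq> \<infinity>" "a \<le> enn2real (p x)"
      by (auto intro: le_enn2real_of_ennreal_le)
    show ?case
    proof (cases "x \<in> ?A")
      case True
      have quarter: "(1 / 4 :: ennreal) = ennreal (1 / 4)"
        by (simp add: divide_ennreal[symmetric])
      have "ennreal (1 / (4 * d)) \<le> ennreal ((1 / 4) / l)"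
        using l d by (intro ennreal_leI) (auto simp: field_simps)
      also have "\<dots> = ennreal (1 / 4) / ennreal l"
        using l by (simp add: divide_ennreal)
      also have "\<dots> \<le> modulus v x / ennreal l"
        using True quarter by (intro divide_right_mono_ennreal) auto
      finally have "enn_powr (ennreal (1 / (4 * d))) (p x) \<le> enn_powr (modulus v x / ennreal l) (p x)"
        by (rule enn_powr_mono)
      moreover have "?c \<le> (1 / (4 * d)) powr enn2real (p x)"
        using px d by (intro powr_mono) auto
      ultimately show ?thesis
        using True px d by (simp add: enn_powr_ennreal) (meson ennreal_leI order_trans)
    qed simp
  qed
  also have "\<dots> \<le> 1" by (rule l(3))
  finally have "ennreal ((4 * d) powr a) * (ennreal ?c * emeasure M ?A) \<le> ennreal ((4 * d) powr a) * 1"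
    by (rule mult_left_mono) simp
  moreover have "(4 * d) powr a * ?c = (4 * d * (1 / (4 * d))) powr a"
    by (rule powr_mult[symmetric])
  then have "ennreal ((4 * d) powr a) * ennreal ?c = 1"
    using d by (simp add: ennreal_mult[symmetric])
  ultimately show ?thesis by (simp flip: mult.assoc)
qed

section \<open>Mixed norms of dominated sequences\<close>

text \<open>The two halves \<open>k \<ge> 0\<close> and \<open>k < 0\<close> each contribute at most a full geometric series.\<close>

lemma sum_geometric_weights_le:
  fixes t :: real
  assumes t: "0 < t" "t < 1" and "finite F"
  shows "(\<Sum>k\<in>F. (1 - t) / 2 * t ^ nat \<bar>k\<bar>) \<le> 1"
proof -
  have half: "(\<Sum>k\<in>G. t ^ nat \<bar>k\<bar>) \<le> 1 / (1 - t)"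
    if "finite G" "inj_on (\<lambda>k. nat \<bar>k\<bar>) G" for G :: "int set"
  proof -
    have "(\<Sum>k\<in>G. t ^ nat \<bar>k\<bar>) = (\<Sum>n\<in>(\<lambda>k. nat \<bar>k\<bar>) ` G. t ^ n)"
      using that by (simp add: sum.reindex)
    also have "\<dots> \<le> (\<Sum>n. t ^ n)"
      using that t by (intro sum_le_suminf) (auto simp: summable_geometric)
    also have "\<dots> = 1 / (1 - t)" using t by (intro suminf_geometric) auto
    finally show ?thesis .
  qed
  have "(\<Sum>k\<in>F. t ^ nat \<bar>k\<bar>) = (\<Sum>k\<in>{k\<in>F. 0 \<le> k}. t ^ nat \<bar>k\<bar>) + (\<Sum>k\<in>{k\<in>F. \<not> 0 \<le> k}. t ^ nat \<bar>k\<bar>)"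
    using \<open>finite F\<close> by (subst sum.union_disjoint[symmetric]) (auto intro!: sum.cong)
  also have "\<dots> \<le> 1 / (1 - t) + 1 / (1 - t)"
    using \<open>finite F\<close> by (intro add_mono half) (auto simp: inj_on_def)
  finally have "(1 - t) / 2 * (\<Sum>k\<in>F. t ^ nat \<bar>k\<bar>) \<le> (1 - t) / 2 * (1 / (1 - t) + 1 / (1 - t))"
    using t by (intro mult_left_mono) auto
  also have "\<dots> = 1" using t by (simp add: distrib_left)
  finally show ?thesis by (simp add: sum_distrib_left)
qed

lemma infsum_ennreal_le_of_sum_le:
  assumes "\<And>k. 0 \<le> w k" and "\<And>F. finite F \<Longrightarrow> sum w F \<le> c"
  shows "(\<Sum>\<^sub>\<infinity>k. ennreal (w k)) \<le> ennreal c"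
proof (rule infsum_le_finite_sums)
  show "(\<lambda>k. ennreal (w k)) summable_on UNIV"
    by (rule nonneg_summable_on_complete) simp
qed (use assms in \<open>auto intro!: ennreal_leI\<close>)

text \<open>The domination is the one for which \<open>c k powr q \<le> E powr q * w k\<close>, so the weights sum up to at
  most \<open>1\<close>. For \<open>q = \<infinity>\<close> the weight has exponent \<open>0\<close> and the bound reads \<open>c k \<le> E\<close>.\<close>

lemma lq_qnorm_le_of_dominated:
  assumes "0 < q" "0 \<le> E" and w: "\<And>k. 0 < w k" "\<And>F. finite F \<Longrightarrow> sum w F \<le> 1"
    and c: "\<And>k. c k \<le> ennreal E * enn_powr (ennreal (w k)) (inverse q)"
  shows "lq_qnorm q c \<le> ennreal E"
proof (cases "q = \<infinity>")
  case True
  have "enn_powr (ennreal (w k)) 0 = 1" for k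
    using w(1)[of k] by (simp add: enn_powr_ennreal)
  then show ?thesis
    using c True by (auto simp: lq_qnorm_def intro!: SUP_least)
next
  case False
  obtain t where t: "q = ennreal t" "0 < t"
    using False \<open>0 < q\<close> by (cases q) (auto simp: top_unique)
  have inv: "inverse q = ennreal (1 / t)"
    using t by (simp add: inverse_ennreal inverse_eq_divide)
  then have root: "enn2real (inverse q) = 1 / t" "inverse q \<noteq> \<infinity>"
    using t by auto
  have "enn_powr (c k) q \<le> ennreal (E powr t * w k)" for k
  proof -
    have "enn_powr (ennreal (w k)) (inverse q) = ennreal (w k powr (1 / t))"
      using enn_powr_ennreal[OF less_imp_le[OF w(1)] root(2), of k] by (simp only: root(1))
    then have "c k \<le> ennreal (E * w k powr (1 / t))"
      using c[of k] \<open>0 \<le> E\<close> by (simp add: ennreal_mult)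
    then have "enn_powr (c k) q \<le> enn_powr (ennreal (E * w k powr (1 / t))) q"
      by (rule enn_powr_mono)
    also have "\<dots> = ennreal (E powr t * w k)"
      using t \<open>0 \<le> E\<close> w(1)[of k] by (simp add: enn_powr_ennreal powr_mult powr_powr)
    finally show ?thesis .
  qed
  then have "(\<Sum>\<^sub>\<infinity>k. enn_powr (c k) q) \<le> (\<Sum>\<^sub>\<infinity>k. ennreal (E powr t * w k))"
    by (intro infsum_mono nonneg_summable_on_complete) auto
  also have "\<dots> \<le> ennreal (E powr t)"
  proof (rule infsum_ennreal_le_of_sum_le)
    show "0 \<le> E powr t * w k" for k using w(1)[of k] by simp
    show "(\<Sum>k\<in>F. E powr t * w k) \<le> E powr t" if "finite F" for F
      using mult_left_mono[OF w(2)[OF that], of "E powr t"] by (simp add: sum_distrib_left)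
  qed
  finally have "lq_qnorm q c \<le> enn_powr (ennreal (E powr t)) (inverse q)"
    using False by (simp add: lq_qnorm_def enn_powr_mono)
  also have "\<dots> = ennreal ((E powr t) powr (1 / t))"
    by (simp only: enn_powr_ennreal[OF _ root(2)] root(1) powr_ge_zero)
  also have "(E powr t) powr (1 / t) = E"
    using t \<open>0 \<le> E\<close> by (simp add: powr_powr)
  finally show ?thesis .
qed

text \<open>One pointwise domination serves both mixed quasi-norms. In \<open>L\<^sup>p(\<ell>\<^sup>q)\<close> it bounds the inner
  \<open>\<ell>\<^sup>q\<close>-quasi-norm by \<open>E 1\<^sub>S\<close>. In \<open>\<ell>\<^sup>q(L\<^sup>p)\<close> the weight \<open>w k\<close> itself is admissible in the infimum that
  defines the \<open>k\<close>-th summand, since dividing \<open>g k\<close> by \<open>w k powr (1 / q x)\<close> leaves at most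
  \<open>E 1\<^sub>S\<close>.\<close>

lemma mixed_qnorms_le_of_dominated:
  assumes p: "AE x in M. ennreal a \<le> p x \<and> p x < \<infinity>" and "0 < a"
    and S: "S \<in> sets M" "emeasure M S \<le> ennreal V" "1 \<le> V"
    and "0 < E" and w: "\<And>k. 0 < w k" "\<And>F. finite F \<Longrightarrow> sum w F \<le> 1"
    and g: "AE x in M. 0 < q x \<and>
      (\<forall>k. g k x \<le> ennreal E * enn_powr (ennreal (w k)) (inverse (q x)) * indicator S x)"
  shows "Lp_lq_qnorm M p q g \<le> ennreal (E * V powr (1 / a))"
    and "lq_Lp_qnorm M p q g \<le> ennreal (E * V powr (1 / a))"
proof -
  let ?l = "V powr (1 / a)"
  have inv: "1 / ?l = V powr (- 1 / a)" by (simp add: powr_minus divide_inverse)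
  have El: "0 < E * ?l" using S \<open>0 < E\<close> by simp
  show "Lp_lq_qnorm M p q g \<le> ennreal (E * ?l)"
    unfolding Lp_lq_qnorm_def
  proof (rule Lp_qnorm_le_of_bounded_on[OF p \<open>0 < a\<close> S \<open>0 < E\<close>])
    show "AE x in M. lq_qnorm (q x) (\<lambda>k. g k x) \<le> ennreal E * indicator S x"
      using g
    proof eventually_elim
      case (elim x)
      have "lq_qnorm (q x) (\<lambda>k. g k x) \<le> ennreal (E * indicator S x)"
        using elim \<open>0 < E\<close>
        by (intro lq_qnorm_le_of_dominated[OF _ _ w]) (auto simp: indicator_def)
      then show ?case by (cases "x \<in> S") auto
    qed
  qed
  have "Inf {ennreal l | l. 0 < l \<and>
      modular M p (\<lambda>x. g k x / ennreal (E * ?l) / enn_powr (ennreal l) (inverse (q x))) \<le> 1}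
      \<le> ennreal (w k)" for k
  proof (rule Inf_lower, intro CollectI exI[of _ "w k"] conjI)
    show "0 < w k" by (rule w)
    show "modular M p (\<lambda>x. g k x / ennreal (E * ?l) / enn_powr (ennreal (w k)) (inverse (q x))) \<le> 1"
    proof (rule modular_le_one_of_scaled[OF p \<open>0 < a\<close> S], use g in eventually_elim)
      case (elim x)
      let ?t = "enn_powr (ennreal (w k)) (inverse (q x))"
      have "inverse (q x) \<noteq> \<infinity>" using elim by auto
      then have t: "?t = ennreal (w k powr enn2real (inverse (q x)))"
        using w(1)[of k] by (intro enn_powr_ennreal) auto
      have "?t \<noteq> 0" "?t < \<infinity>" using w(1)[of k] by (auto simp: t)
      have "g k x / ennreal (E * ?l) \<le> ennreal (1 / ?l) * (?t * indicator S x)"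
        using elim \<open>0 < E\<close> S by (intro divide_le_of_le_mult_ennreal) (auto simp: mult.assoc)
      then have "g k x / ennreal (E * ?l) / ?t \<le> ennreal (1 / ?l) * (?t * indicator S x) / ?t"
        by (rule divide_right_mono_ennreal)
      also have "\<dots> = ennreal (1 / ?l) * indicator S x * (?t / ?t)"
        by (simp add: ennreal_times_divide mult_ac)
      also have "\<dots> = ennreal (V powr (- 1 / a)) * indicator S x"
        using \<open>?t \<noteq> 0\<close> \<open>?t < \<infinity>\<close> inv by simp
      finally show ?case .
    qed
  qed simp
  then have "lq_Lp_modular M p q (\<lambda>k x. g k x / ennreal (E * ?l)) \<le> (\<Sum>\<^sub>\<infinity>k. ennreal (w k))"
    unfolding lq_Lp_modular_def by (intro infsum_mono nonneg_summable_on_complete) auto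
  also have "\<dots> \<le> ennreal 1"
    using w by (intro infsum_ennreal_le_of_sum_le) (auto intro: less_imp_le)
  finally show "lq_Lp_qnorm M p q g \<le> ennreal (E * ?l)"
    unfolding lq_Lp_qnorm_def using El by (intro Inf_lower) auto
qed


section \<open>Lipschitz bumps\<close>

text \<open>At small distances (\<open>k \<ge> 0\<close>) the Lipschitz bound \<open>d / r\<close> is used and the decay comes from
  \<open>d powr (1 - t) \<le> d powr \<eta>\<close>. At distances at least \<open>1\<close> the trivial bound \<open>1\<close> is used and the
  growth of \<open>d powr t \<ge> d powr \<eta>\<close> pays for the decaying factor, up to a factor \<open>2 powr \<eta> \<le> 2\<close> that
  \<open>1 / r \<ge> 2\<close> absorbs.\<close>

lemma dyadic_Lipschitz_bound:
  fixes r \<eta> t d :: real and k :: int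
  assumes r: "0 < r" "r \<le> 1 / 2" and \<eta>: "0 \<le> \<eta>" "\<eta> \<le> t" "t \<le> 1 - \<eta>"
    and d: "2 powi (- k - 1) \<le> d" "d < 2 powi (- k)"
  shows "min 1 (d / r) \<le> d powr t * (1 / r * 2 powr (- \<eta> * real_of_int \<bar>k\<bar>))"
proof -
  have powi: "2 powr real_of_int n = (2::real) powi n" for n
    by (rule powr_real_of_int') auto
  have d': "2 powr (real_of_int (- k - 1)) \<le> d" "d < 2 powr (real_of_int (- k))"
    using d by (simp_all only: powi)
  have "0 < d" using d'(1) by (rule less_le_trans[rotated]) simp
  show ?thesis
  proof (cases "0 \<le> k")
    case True
    have "d \<le> 1"
      using d'(2) True powr_mono[of "real_of_int (- k)" 0 2] by simp
    have "d powr (1 - t) \<le> d powr \<eta>"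
      using \<eta> \<open>0 < d\<close> \<open>d \<le> 1\<close> by (intro powr_mono') auto
    also have "\<dots> \<le> (2 powr (real_of_int (- k))) powr \<eta>"
      using d' \<open>0 < d\<close> \<eta> by (intro powr_mono2) auto
    also have "\<dots> = 2 powr (- \<eta> * real_of_int \<bar>k\<bar>)"
      using True by (simp add: powr_powr mult.commute)
    finally have "d powr t * d powr (1 - t) / r \<le> d powr t * 2 powr (- \<eta> * real_of_int \<bar>k\<bar>) / r"
      using r by (intro divide_right_mono mult_left_mono) auto
    moreover have "d powr t * d powr (1 - t) = d"
      using \<open>0 < d\<close> by (simp flip: powr_add)
    ultimately show ?thesis by simp
  next
    case False
    have "2 powr 0 \<le> (2::real) powr (real_of_int (- k - 1))"
      using False by (intro powr_mono) auto
    then have "1 \<le> d" using d'(1) by simp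
    have "1 \<le> 1 / r * (1 / 2)"
      using r by (simp add: field_simps)
    also have "\<dots> \<le> 1 / r * 2 powr (- \<eta>)"
      using r \<eta> powr_mono[of "-1" "- \<eta>" 2] by (intro mult_left_mono) (auto simp: powr_minus)
    also have "\<dots> = (2 powr (real_of_int (- k - 1))) powr \<eta> * (1 / r * 2 powr (- \<eta> * real_of_int \<bar>k\<bar>))"
    proof -
      have "(2 powr (real_of_int (- k - 1))) powr \<eta> * 2 powr (- \<eta> * real_of_int \<bar>k\<bar>)
          = 2 powr (real_of_int (- k - 1) * \<eta> + - \<eta> * real_of_int \<bar>k\<bar>)"
        by (simp only: powr_powr powr_add)
      also have "real_of_int (- k - 1) * \<eta> + - \<eta> * real_of_int \<bar>k\<bar> = - \<eta>"
        using False by (simp add: algebra_simps)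
      finally show ?thesis by (simp only: mult.left_commute)
    qed
    also have "\<dots> \<le> d powr \<eta> * (1 / r * 2 powr (- \<eta> * real_of_int \<bar>k\<bar>))"
      using d' \<eta> r by (intro mult_right_mono powr_mono2) auto
    also have "\<dots> \<le> d powr t * (1 / r * 2 powr (- \<eta> * real_of_int \<bar>k\<bar>))"
      using \<open>1 \<le> d\<close> \<eta> r by (intro mult_right_mono powr_mono) auto
    finally show ?thesis by simp
  qed
qed

definition Lipschitz_bump :: "real \<Rightarrow> 'a::metric_space set \<Rightarrow> ('a \<Rightarrow> real) \<Rightarrow> bool" where
  "Lipschitz_bump r S u \<longleftrightarrow> (\<forall>x. 0 \<le> u x \<and> u x \<le> 1) \<and> (\<forall>x. x \<notin> S \<longrightarrow> u x = 0) \<and>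
     (\<forall>x y. \<bar>u x - u y\<bar> \<le> dist x y / r)"

lemma Lipschitz_bump_measurable:
  assumes "Lipschitz_bump r S u" "0 < r"
  shows "u \<in> borel_measurable borel"
proof (rule borel_measurable_continuous_onI)
  have "dist (u x) (u y) < e" if "dist x y < e * r" for x y e
  proof -
    have "dist (u x) (u y) \<le> dist x y / r"
      using assms(1) by (simp add: Lipschitz_bump_def dist_real_def)
    also have "\<dots> < e" using that assms(2) by (simp add: field_simps)
    finally show ?thesis .
  qed
  then show "continuous_on UNIV u"
    unfolding continuous_on_iff using assms(2) by (metis dist_commute mult_pos_pos)
qed

text \<open>If neither of the two points lies in \<open>S\<close>, there is nothing to bound; otherwise the summand of
  a point in \<open>S\<close> alone dominates the difference, by the dyadic estimate.\<close>

lemma Lipschitz_bump_vector_gradient: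
  fixes M :: "'a::metric_space measure" and u :: "'a \<Rightarrow> real" and r \<eta> :: real
  assumes "space M = UNIV" and r: "0 < r" "r \<le> 1 / 2" and "0 \<le> \<eta>"
    and s: "AE x in M. ennreal \<eta> \<le> s x \<and> s x \<le> ennreal (1 - \<eta>)"
    and S: "S \<in> sets M"
    and bump: "Lipschitz_bump r S u"
  shows "(\<lambda>k x. ennreal (1 / r * 2 powr (- \<eta> * real_of_int \<bar>k\<bar>)) * indicator S x)
    \<in> vector_gradients M s (\<lambda>x. ereal (u x))"
proof -
  have u: "\<And>x. 0 \<le> u x" "\<And>x. u x \<le> 1" "\<And>x. x \<notin> S \<Longrightarrow> u x = 0"
    "\<And>x y. \<bar>u x - u y\<bar> \<le> dist x y / r"
    using bump by (auto simp: Lipschitz_bump_def)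
  let ?c = "\<lambda>k::int. 1 / r * 2 powr (- \<eta> * real_of_int \<bar>k\<bar>)"
  obtain N where N: "N \<in> null_sets M" "{x. \<not> (ennreal \<eta> \<le> s x \<and> s x \<le> ennreal (1 - \<eta>))} \<subseteq> N"
    using s \<open>space M = UNIV\<close> unfolding eventually_ae_filter by auto
  have bound: "ennreal (min 1 (d / r)) \<le> enn_powr (ennreal d) (s x) * ennreal (?c k)"
    if "x \<notin> N" "2 powi (- k - 1) \<le> d" "d < 2 powi (- k)" for x d k
  proof -
    have sx: "ennreal \<eta> \<le> s x" "s x \<le> ennreal (1 - \<eta>)" using N that by auto
    then have fin: "s x \<noteq> \<infinity>" by (auto simp: top_unique)
    then obtain t where t: "s x = ennreal t" "0 \<le> t" by (cases "s x") auto
    have "0 < 1 - \<eta> \<or> t = 0" using sx t by (cases "0 < 1 - \<eta>") (auto simp: ennreal_neg)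
    then have t': "\<eta> \<le> t" "t \<le> 1 - \<eta>"
      using sx t \<open>0 \<le> \<eta>\<close> by (auto simp: ennreal_le_iff2)
    have "0 \<le> d" using that(2) zero_le_power_int[of "2::real" "- k - 1"] by linarith
    have "min 1 (d / r) \<le> d powr t * ?c k"
      by (rule dyadic_Lipschitz_bound[OF r \<open>0 \<le> \<eta>\<close> t' that(2,3)])
    then have "ennreal (min 1 (d / r)) \<le> ennreal (d powr t * ?c k)" by (rule ennreal_leI)
    also have "\<dots> = ennreal (d powr t) * ennreal (?c k)"
      using r by (intro ennreal_mult) auto
    also have "ennreal (d powr t) = enn_powr (ennreal d) (s x)"
      using enn_powr_ennreal[OF \<open>0 \<le> d\<close> fin] t by simp
    finally show ?thesis .
  qed
  have "e2ennreal \<bar>ereal (u x) - ereal (u y)\<bar> \<le>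
      enn_powr (ennreal (dist x y)) (s x) * (ennreal (?c k) * indicator S x) +
      enn_powr (ennreal (dist x y)) (s y) * (ennreal (?c k) * indicator S y)"
    if "x \<notin> N" "y \<notin> N" and d: "2 powi (- k - 1) \<le> dist x y" "dist x y < 2 powi (- k)" for x y k
  proof -
    have "\<bar>u x - u y\<bar> \<le> min 1 (dist x y / r)"
      using u(1,2)[of x] u(1,2)[of y] u(4)[of x y] by auto
    then have le: "e2ennreal \<bar>ereal (u x) - ereal (u y)\<bar> \<le> ennreal (min 1 (dist x y / r))"
      by (simp add: ennreal_leI)
    consider "x \<in> S" | "y \<in> S" | "x \<notin> S" "y \<notin> S" by blast
    then show ?thesis
    proof cases
      case 1
      have "enn_powr (ennreal (dist x y)) (s x) * ennreal (?c k) \<le>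
          enn_powr (ennreal (dist x y)) (s x) * (ennreal (?c k) * indicator S x) +
          enn_powr (ennreal (dist x y)) (s y) * (ennreal (?c k) * indicator S y)"
        using 1 by simp
      with le bound[OF that(1) d] show ?thesis by (meson order_trans)
    next
      case 2
      have "enn_powr (ennreal (dist x y)) (s y) * ennreal (?c k) \<le>
          enn_powr (ennreal (dist x y)) (s x) * (ennreal (?c k) * indicator S x) +
          enn_powr (ennreal (dist x y)) (s y) * (ennreal (?c k) * indicator S y)"
        using 2 by simp
      with le bound[OF that(2) d] show ?thesis by (meson order_trans)
    next
      case 3
      then show ?thesis using u(3) by (simp add: e2ennreal_neg)
    qed
  qed
  note grad = this
  show ?thesis
    unfolding vector_gradients_def
  proof (intro CollectI conjI allI bexI[OF _ N(1)] ballI impI)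
    show "(\<lambda>x. ennreal (?c k) * indicator S x) \<in> borel_measurable M" for k
      using S by measurable
  qed (rule grad; simp)
qed

text \<open>If \<open>q\<close> is only bounded below by \<open>b\<close>, geometric weights with ratio \<open>t = 2 powr (- \<eta> b)\<close> make the
  coefficients a multiple of \<open>w k powr (1 / b)\<close>, and \<open>w k \<le> 1\<close> allows \<open>1 / b\<close> to be lowered to
  \<open>1 / q x\<close>. If \<open>q\<close> is infinite almost everywhere, the exponent is \<open>0\<close> and any weights will do.\<close>

lemma dyadic_weights_dominate:
  assumes q: "q \<in> exponents M" and s: "s \<in> bounded_exponents M"
    and sq: "esssup M s < 1 \<and> essinf M q < \<infinity> \<or> esssup M s \<le> 1 \<and> essinf M q = \<infinity>"
    and "0 < r"
  obtains \<eta> E w where "0 \<le> \<eta>" "0 < E"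
    "AE x in M. ennreal \<eta> \<le> s x \<and> s x \<le> ennreal (1 - \<eta>)"
    "\<forall>k::int. 0 < w k" "\<forall>F. finite F \<longrightarrow> sum w F \<le> 1"
    "AE x in M. 0 < q x \<and>
      (\<forall>k. ennreal (1 / r * 2 powr (- \<eta> * real_of_int \<bar>k\<bar>)) \<le> ennreal E * enn_powr (ennreal (w k)) (inverse (q x)))"
  using sq
proof
  assume sq: "esssup M s < 1 \<and> essinf M q < \<infinity>"
  obtain a :: real where a: "0 < a" "AE x in M. ennreal a \<le> s x \<and> s x < \<infinity>"
    using bounded_exponent_AE[OF s] .
  obtain b :: real where b: "0 < b" "AE x in M. ennreal b \<le> q x"
    using q AE_lower_bound_of_essinf_pos[of M q] by (auto simp: exponents_def)
  define \<sigma> where "\<sigma> = enn2real (esssup M s)"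
  have esss: "esssup M s = ennreal \<sigma>"
    using sq less_trans[OF _ ennreal_one_less_top, of "esssup M s"] by (simp add: \<sigma>_def)
  have \<sigma>: "0 \<le> \<sigma>" by (simp add: \<sigma>_def)
  moreover have "\<sigma> < 1" using sq \<sigma> unfolding esss by (simp add: ennreal_less_one_iff)
  ultimately have \<sigma>: "0 \<le> \<sigma>" "\<sigma> < 1" .
  \<comment> \<open>The lower bound \<open>a\<close> of \<open>s\<close> provides the decay for \<open>k < 0\<close>, the gap between its upper bound
    \<open>\<sigma>\<close> and \<open>1\<close> the decay for \<open>k \<ge> 0\<close>.\<close>
  define \<eta> where "\<eta> = min a (1 - \<sigma>)"
  have \<eta>: "0 < \<eta>" "\<eta> \<le> a" "\<sigma> \<le> 1 - \<eta>" using a \<sigma> by (auto simp: \<eta>_def)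
  define t :: real where "t = 2 powr (- \<eta> * b)"
  have t: "0 < t" "t < 1"
    using \<eta> b powr_less_mono[of "- \<eta> * b" 0 2] by (auto simp: t_def)
  define w where "w k = (1 - t) / 2 * t ^ nat \<bar>k\<bar>" for k :: int
  \<comment> \<open>The second factor undoes the normalisation \<open>(1 - t) / 2\<close> of the weights.\<close>
  define E where "E = 1 / r * (2 / (1 - t)) powr (1 / b)"
  have w: "0 < w k" "w k \<le> 1" for k
    using t sum_geometric_weights_le[OF t, of "{k}"] by (auto simp: w_def)
  have weights: "1 / r * 2 powr (- \<eta> * real_of_int \<bar>k\<bar>) = E * w k powr (1 / b)" for k
  proof -
    have "t ^ nat \<bar>k\<bar> = t powr real (nat \<bar>k\<bar>)"
      by (rule powr_realpow[symmetric, OF t(1)])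
    also have "\<dots> = 2 powr (- \<eta> * real_of_int \<bar>k\<bar> * b)"
      by (simp add: t_def powr_powr mult_ac)
    finally have "(2 / (1 - t) * w k) powr (1 / b) = (2 powr (- \<eta> * real_of_int \<bar>k\<bar> * b)) powr (1 / b)"
      using t by (simp add: w_def)
    also have "\<dots> = 2 powr (- \<eta> * real_of_int \<bar>k\<bar>)"
      using b by (simp add: powr_powr)
    finally show ?thesis
      unfolding E_def powr_mult by (simp only: mult.assoc)
  qed
  show ?thesis
  proof (rule that[of \<eta> E w])
    show "0 \<le> \<eta>" using \<eta> by simp
    show "0 < E" using \<open>0 < r\<close> t by (simp add: E_def)
    show "AE x in M. ennreal \<eta> \<le> s x \<and> s x \<le> ennreal (1 - \<eta>)"
      using a(2) esssup_AE[of s M]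
    proof eventually_elim
      case (elim x)
      have "ennreal \<eta> \<le> ennreal a" "ennreal \<sigma> \<le> ennreal (1 - \<eta>)"
        using \<eta> by (auto intro: ennreal_leI)
      then show ?case using elim unfolding esss by (auto intro: order_trans)
    qed
    show "\<forall>F. finite F \<longrightarrow> sum w F \<le> 1"
      using sum_geometric_weights_le[OF t] by (simp add: w_def)
    show "\<forall>k. 0 < w k" using w by simp
    show "AE x in M. 0 < q x \<and>
      (\<forall>k. ennreal (1 / r * 2 powr (- \<eta> * real_of_int \<bar>k\<bar>)) \<le> ennreal E * enn_powr (ennreal (w k)) (inverse (q x)))"
      using b(2)
    proof eventually_elim
      case (elim x)
      then have "0 < q x" using b less_le_trans[of 0 "ennreal b" "q x"] by simp
      have iq: "enn2real (inverse (q x)) \<le> 1 / b" "inverse (q x) \<noteq> \<infinity>"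
      proof -
        show "inverse (q x) \<noteq> \<infinity>" using \<open>0 < q x\<close> by auto
        show "enn2real (inverse (q x)) \<le> 1 / b"
        proof (cases "q x")
          case (real t)
          then have "b \<le> t" using elim by (simp add: ennreal_le_iff)
          moreover have "inverse (q x) = ennreal (1 / t)"
            using real b \<open>b \<le> t\<close> by (simp add: inverse_ennreal inverse_eq_divide)
          ultimately show ?thesis
            using b by (simp add: frac_le)
        qed (use b in simp)
      qed
      have "ennreal (1 / r * 2 powr (- \<eta> * real_of_int \<bar>k\<bar>)) \<le> ennreal E * enn_powr (ennreal (w k)) (inverse (q x))" for k
      proof -
        have "E * w k powr (1 / b) \<le> E * w k powr enn2real (inverse (q x))"
          using w[of k] iq \<open>0 < E\<close> by (intro mult_left_mono powr_mono') auto
        then show ?thesis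
          unfolding weights enn_powr_ennreal[OF less_imp_le[OF w(1)] iq(2)]
          using \<open>0 < E\<close> by (simp only: ennreal_leI ennreal_mult[symmetric] less_imp_le powr_ge_zero)
      qed
      then show ?case using \<open>0 < q x\<close> by blast
    qed
  qed
next
  assume sq: "esssup M s \<le> 1 \<and> essinf M q = \<infinity>"
  have half: "0 < (1 / 2 :: real)" "1 / 2 < (1 :: real)" by auto
  define w where "w k = (1 - 1 / 2) / 2 * (1 / 2 :: real) ^ nat \<bar>k\<bar>" for k :: int
  show ?thesis
  proof (rule that[of 0 "1 / r" w])
    show "AE x in M. ennreal 0 \<le> s x \<and> s x \<le> ennreal (1 - 0)"
      using esssup_AE[of s M] by eventually_elim (use sq in auto)
    show w: "\<forall>k. 0 < w k" by (simp add: w_def)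
    show "\<forall>F. finite F \<longrightarrow> sum w F \<le> 1"
      using sum_geometric_weights_le[OF half] by (simp add: w_def)
    have "enn_powr (ennreal (w k)) 0 = 1" for k
      using w[rule_format, of k] by (simp add: enn_powr_ennreal)
    then show "AE x in M. 0 < q x \<and> (\<forall>k. ennreal (1 / r * 2 powr (- 0 * real_of_int \<bar>k\<bar>))
        \<le> ennreal (1 / r) * enn_powr (ennreal (w k)) (inverse (q x)))"
      using AE_infinite_of_essinf_infinite[of M q] sq by (auto elim: eventually_mono)
  qed (use \<open>0 < r\<close> in auto)
qed

text \<open>The constant depends on the bump only through \<open>r\<close> and the bound \<open>V\<close> for the measure of its
  support.\<close>

lemma Lipschitz_bump_norm_bound:
  fixes M :: "'a::metric_space measure"
  assumes M: "sets M = sets borel" and r: "0 < r" "r \<le> 1 / 2" and V: "1 \<le> V"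
    and s: "s \<in> bounded_exponents M" and p: "p \<in> bounded_exponents M" and q: "q \<in> exponents M"
    and sq: "esssup M s < 1 \<and> essinf M q < \<infinity> \<or> esssup M s \<le> 1 \<and> essinf M q = \<infinity>"
  obtains C where "C < \<infinity>"
    "\<forall>S u. S \<in> sets M \<and> emeasure M S \<le> ennreal V \<and> Lipschitz_bump r S u \<longrightarrow>
      (\<lambda>x. ereal (u x)) \<in> Lp_space M p \<and>
      M_norm M s p q (\<lambda>x. ereal (u x)) \<le> C \<and> N_norm M s p q (\<lambda>x. ereal (u x)) \<le> C"
proof -
  obtain a :: real where a: "0 < a" and pa: "AE x in M. ennreal a \<le> p x \<and> p x < \<infinity>"
    using bounded_exponent_AE[OF p] .
  obtain \<eta> E w where \<eta>: "0 \<le> \<eta>" and E: "0 < E"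
    and s\<eta>: "AE x in M. ennreal \<eta> \<le> s x \<and> s x \<le> ennreal (1 - \<eta>)"
    and w: "\<forall>k::int. 0 < w k" "\<forall>F. finite F \<longrightarrow> sum w F \<le> 1"
    and dom: "AE x in M. 0 < q x \<and>
      (\<forall>k. ennreal (1 / r * 2 powr (- \<eta> * real_of_int \<bar>k\<bar>)) \<le> ennreal E * enn_powr (ennreal (w k)) (inverse (q x)))"
    by (rule dyadic_weights_dominate[OF q s sq r(1)])
  have w': "0 < w k" "finite F \<Longrightarrow> sum w F \<le> 1" for k F using w by auto
  let ?l = "V powr (1 / a)"
  show ?thesis
  proof (rule that[of "ennreal ?l + ennreal (E * ?l)"])
    show "ennreal ?l + ennreal (E * ?l) < \<infinity>"
      using V E by (simp flip: ennreal_plus)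
  next
    show "\<forall>S u. S \<in> sets M \<and> emeasure M S \<le> ennreal V \<and> Lipschitz_bump r S u \<longrightarrow>
      (\<lambda>x. ereal (u x)) \<in> Lp_space M p \<and>
      M_norm M s p q (\<lambda>x. ereal (u x)) \<le> ennreal ?l + ennreal (E * ?l) \<and>
      N_norm M s p q (\<lambda>x. ereal (u x)) \<le> ennreal ?l + ennreal (E * ?l)"
    proof (intro allI impI, elim conjE)
      fix S and u :: "'a \<Rightarrow> real"
      assume S: "S \<in> sets M" "emeasure M S \<le> ennreal V" and bump: "Lipschitz_bump r S u"
      have u: "\<And>x. 0 \<le> u x" "\<And>x. u x \<le> 1" "\<And>x. x \<notin> S \<Longrightarrow> u x = 0"
        using bump by (auto simp: Lipschitz_bump_def)
      let ?u = "\<lambda>x. ereal (u x)"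
      let ?g = "\<lambda>(k::int) x. ennreal (1 / r * 2 powr (- \<eta> * real_of_int \<bar>k\<bar>)) * indicator S x"
      have measM: "u \<in> borel_measurable M"
        using Lipschitz_bump_measurable[OF bump r(1)] M by (simp cong: measurable_cong_sets)
      have mod: "modulus ?u x \<le> ennreal 1 * indicator S x" for x
        using u(1,2,3)[of x] by (cases "x \<in> S") (auto simp: modulus_def ennreal_le_1)
      have Lp: "Lp_norm M p ?u \<le> ennreal ?l"
        using Lp_qnorm_le_of_bounded_on[OF pa a(1) S V, of 1] mod by simp
      have "modular M p (\<lambda>x. ennreal 1 * modulus ?u x) \<le> ennreal (1 powr a) * emeasure M S"
        by (rule modular_le_of_small[OF pa a(1) _ _ S(1)]) (use mod in auto)
      also have "\<dots> < \<infinity>" using le_less_trans[OF S(2), of "\<infinity>"] by simp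
      finally have space: "?u \<in> Lp_space M p"
        using measM unfolding Lp_space_def by (auto intro!: exI[of _ "1::real"])
      have grad: "?g \<in> vector_gradients M s ?u"
        by (rule Lipschitz_bump_vector_gradient[OF _ r \<eta> s\<eta> S(1) bump])
          (use sets_eq_imp_space_eq[OF M] in simp)
      have "AE x in M. 0 < q x \<and>
        (\<forall>k. ?g k x \<le> ennreal E * enn_powr (ennreal (w k)) (inverse (q x)) * indicator S x)"
        using dom by eventually_elim (auto simp: indicator_def)
      note mixed = mixed_qnorms_le_of_dominated[OF pa a(1) S V E w' this]
      have "M_seminorm M s p q ?u \<le> ennreal (E * ?l)"
        unfolding M_seminorm_def by (rule INF_lower2[OF grad]) (rule mixed)
      moreover have "N_seminorm M s p q ?u \<le> ennreal (E * ?l)"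
        unfolding N_seminorm_def by (rule INF_lower2[OF grad]) (rule mixed)
      ultimately show "?u \<in> Lp_space M p \<and>
        M_norm M s p q ?u \<le> ennreal ?l + ennreal (E * ?l) \<and>
        N_norm M s p q ?u \<le> ennreal ?l + ennreal (E * ?l)"
        using space Lp unfolding M_norm_def N_norm_def by (intro conjI add_mono)
    qed
  qed
qed


section \<open>Escaping bumps\<close>

text \<open>A finite net splits \<open>P\<close> into finitely many parts, one of which is unbounded. Within that part a
  bump at \<open>x\<close> can be chosen outside the bounded support of another bump at \<open>y\<close>, although both are
  close to the same function \<open>f\<close>.\<close>

lemma escaping_bumps_not_totally_bounded:
  fixes M :: "'a::metric_space measure" and v :: "'a \<Rightarrow> 'a \<Rightarrow> real"
  assumes M: "sets M = sets borel" and "\<beta> \<in> bounded_exponents M"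
    and ball: "0 < (INF x. emeasure M (ball x \<rho>))" "0 < \<rho>" and P: "\<not> bounded P"
    and meas: "\<And>x. x \<in> P \<Longrightarrow> v x \<in> borel_measurable borel"
    and large: "\<And>x y. x \<in> P \<Longrightarrow> y \<in> ball x \<rho> \<Longrightarrow> 1 / 2 \<le> v x y"
    and supp: "\<And>x. x \<in> P \<Longrightarrow> bounded {y. v x y \<noteq> 0}"
  shows "\<not> qnorm_totally_bounded (Lp_space M \<beta>) (Lp_norm M \<beta>) ((\<lambda>x y. ereal (v x y)) ` P)"
proof
  assume tb: "qnorm_totally_bounded (Lp_space M \<beta>) (Lp_norm M \<beta>) ((\<lambda>x y. ereal (v x y)) ` P)"
  have space: "space M = UNIV" using sets_eq_imp_space_eq[OF M] by simp
  obtain a :: real where a: "0 < a" and \<beta>: "AE x in M. ennreal a \<le> \<beta> x \<and> \<beta> x < \<infinity>"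
    using bounded_exponent_AE[OF assms(2)] .
  obtain \<gamma> where \<gamma>: "0 < \<gamma>" "ennreal \<gamma> < (INF x. emeasure M (ball x \<rho>))"
  proof -
    obtain z where z: "0 < z" "z < (INF x. emeasure M (ball x \<rho>))"
      using dense[OF ball(1)] by blast
    then have "z \<noteq> \<infinity>" by auto
    then obtain \<gamma> where "z = ennreal \<gamma>" "0 \<le> \<gamma>" by (cases z) auto
    then show thesis using z that[of \<gamma>] by auto
  qed
  \<comment> \<open>Chosen so that two sets of measure at most \<open>(4 d) powr a\<close> cannot cover a ball of measure
    larger than \<open>\<gamma>\<close>.\<close>
  define d where "d = min (1 / 4) ((\<gamma> / 4) powr (1 / a) / 4)"
  have d: "0 < d" "d \<le> 1 / 4" using \<gamma> by (auto simp: d_def)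
  have "(4 * d) powr a \<le> ((\<gamma> / 4) powr (1 / a)) powr a"
    using d a by (intro powr_mono2) (auto simp: d_def)
  also have "\<dots> = \<gamma> / 4" using a \<gamma> by (simp add: powr_powr)
  finally have small: "(4 * d) powr a \<le> \<gamma> / 4" .
  have "0 < ennreal d" using d by simp
  from tb[unfolded qnorm_totally_bounded_def, THEN spec, THEN mp, OF this] obtain F where F: "finite F" "F \<subseteq> Lp_space M \<beta>"
    and near: "\<forall>u\<in>(\<lambda>x y. ereal (v x y)) ` P. \<exists>f\<in>F. Lp_norm M \<beta> (\<lambda>y. u y - f y) < ennreal d"
    by (elim exE conjE) (rule that)
  define Q where "Q f = {x\<in>P. Lp_norm M \<beta> (\<lambda>y. ereal (v x y) - f y) < ennreal d}" for f
  have "P \<subseteq> (\<Union>f\<in>F. Q f)"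
    using near by (auto simp: Q_def)
  then have "\<not> bounded (\<Union>f\<in>F. Q f)"
    using P bounded_subset by blast
  then obtain f where f: "f \<in> F" and unb: "\<not> bounded (Q f)"
    using bounded_UN[OF F(1), of Q] by blast
  have "Q f \<noteq> {}" using unb by auto
  then obtain y where y: "y \<in> Q f" by blast
  then have "bounded {z. v y z \<noteq> 0}" by (intro supp) (simp add: Q_def)
  then obtain R where R: "\<And>z. v y z \<noteq> 0 \<Longrightarrow> dist y z \<le> R"
    unfolding bounded_any_center[where a = y] by auto
  have "\<not> (\<forall>x\<in>Q f. dist y x \<le> R + \<rho>)"
    using unb unfolding bounded_any_center[where a = y] by blast
  then obtain x where x: "x \<in> Q f" "R + \<rho> < dist y x"
    by (auto simp: not_le)
  have zero: "v y z = 0" if "z \<in> ball x \<rho>" for z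
  proof (rule ccontr)
    assume "v y z \<noteq> 0"
    then have "dist y z \<le> R" by (rule R)
    then show False
      using that x(2) dist_triangle[of y x z] by (simp add: dist_commute)
  qed
  have [measurable]: "f \<in> borel_measurable M"
    using f F(2) by (auto simp: Lp_space_def)
  let ?A = "\<lambda>x. {z \<in> space M. 1 / 4 \<le> modulus (\<lambda>z. ereal (v x z) - f z) z}"
  have Q_props: "emeasure M (?A x) \<le> ennreal (\<gamma> / 4)" "?A x \<in> sets M" if "x \<in> Q f" for x
  proof -
    have that: "x \<in> P" "Lp_norm M \<beta> (\<lambda>y. ereal (v x y) - f y) < ennreal d"
      using that by (auto simp: Q_def)
    have [measurable]: "v x \<in> borel_measurable M"
      using meas[of x] that M by (simp cong: measurable_cong_sets)
    have "emeasure M (?A x) \<le> ennreal ((4 * d) powr a)"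
      using that by (intro emeasure_le_of_Lp_norm_less[OF \<beta> a(1) _ d]) auto
    also have "\<dots> \<le> ennreal (\<gamma> / 4)" using small by (rule ennreal_leI)
    finally show "emeasure M (?A x) \<le> ennreal (\<gamma> / 4)" .
    show "?A x \<in> sets M" unfolding modulus_def by measurable
  qed
  have quarter: "(1 / 4 :: ennreal) = ennreal (1 / 4)"
    by (simp add: divide_ennreal[symmetric])
  have "ball x \<rho> \<subseteq> ?A x \<union> ?A y"
  proof
    fix z assume z: "z \<in> ball x \<rho>"
    then have "1 / 2 \<le> v x z" "v y z = 0" using large[of x z] zero x by (auto simp: Q_def)
    then show "z \<in> ?A x \<union> ?A y"
    proof (cases "f z")
      case (real t)
      then have "1 / 4 \<le> \<bar>v x z - t\<bar> \<or> 1 / 4 \<le> \<bar>v y z - t\<bar>"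
        using \<open>1 / 2 \<le> v x z\<close> \<open>v y z = 0\<close> by linarith
      then have "ennreal (1 / 4) \<le> ennreal \<bar>v x z - t\<bar> \<or> ennreal (1 / 4) \<le> ennreal \<bar>v y z - t\<bar>"
        by (blast intro: ennreal_leI)
      then show ?thesis using real by (simp add: space modulus_def quarter)
    qed (simp_all add: space modulus_def)
  qed
  then have "emeasure M (ball x \<rho>) \<le> emeasure M (?A x \<union> ?A y)"
    using Q_props x y by (intro emeasure_mono) auto
  also have "\<dots> \<le> emeasure M (?A x) + emeasure M (?A y)"
    using Q_props x y by (intro emeasure_subadditive) auto
  also have "\<dots> \<le> ennreal (\<gamma> / 4) + ennreal (\<gamma> / 4)"
    using Q_props x y by (intro add_mono) auto
  also have "\<dots> = ennreal (\<gamma> / 4 + \<gamma> / 4)"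
    using \<gamma> by (intro ennreal_plus[symmetric]) auto
  also have "\<dots> \<le> ennreal \<gamma>"
    using \<gamma> by (intro ennreal_leI) auto
  also have "\<dots> < emeasure M (ball x \<rho>)"
    using \<gamma>(2) INF_lower[of x UNIV "\<lambda>x. emeasure M (ball x \<rho>)"] by (rule less_le_trans) simp
  finally show False by simp
qed


section \<open>Orbits\<close>

text \<open>A packing of maximal cardinality exists because the cardinalities are bounded by \<open>K\<close>. A point
  of the orbit at distance at least \<open>2 r\<close> from all its points could be added to it.\<close>

lemma orbit_covered_by_packing:
  fixes x :: "'a::metric_space"
  assumes "orbit_packing H x r \<le> enat K" "0 < r"
  obtains A where "finite A" "card A \<le> K" "\<And>y. y \<in> orbit_of H x \<Longrightarrow> \<exists>\<xi>\<in>A. dist y \<xi> < 2 * r"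
proof -
  define packed where "packed A \<longleftrightarrow> A \<subseteq> orbit_of H x \<and>
     (\<forall>\<xi>\<in>A. \<forall>\<eta>\<in>A. \<xi> \<noteq> \<eta> \<longrightarrow> ball \<xi> r \<inter> ball \<eta> r = {})" for A
  have bound: "finite A \<and> card A \<le> K" if "packed A" for A
  proof -
    have "ecard A \<le> orbit_packing H x r"
      using that unfolding orbit_packing_def packed_def by (intro Sup_upper) auto
    then have "ecard A \<le> enat K" using assms(1) by (rule order_trans)
    then show ?thesis by (auto simp: ecard_def split: if_splits)
  qed
  have "packed {}" by (simp add: packed_def)
  then obtain A where A: "packed A" "\<And>B. packed B \<Longrightarrow> card B \<le> card A"
    using ex_has_greatest_nat[of packed "{}" card "Suc K"] bound by (auto simp: less_Suc_eq_le)
  have "\<exists>\<xi>\<in>A. dist y \<xi> < 2 * r" if y: "y \<in> orbit_of H x" for y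
  proof (rule ccontr)
    assume far: "\<not> (\<exists>\<xi>\<in>A. dist y \<xi> < 2 * r)"
    then have "y \<notin> A" using \<open>0 < r\<close> by force
    have "ball y r \<inter> ball \<xi> r = {}" if "\<xi> \<in> A" for \<xi>
      using far that by (intro disjoint_ballI) auto
    then have "packed (insert y A)"
      using A(1) y unfolding packed_def by (auto simp: Int_commute)
    then have "card (insert y A) \<le> card A" by (rule A(2))
    then show False using \<open>y \<notin> A\<close> bound[OF A(1)] by simp
  qed
  then show ?thesis using bound[OF A(1)] that[of A] by blast
qed

definition orbit_bump :: "('a::metric_space \<Rightarrow> 'a) set \<Rightarrow> real \<Rightarrow> 'a \<Rightarrow> 'a \<Rightarrow> real" where
  "orbit_bump H r x y = max 0 (1 - infdist y (orbit_of H x) / r)"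

lemma orbit_bump_is_Lipschitz_bump:
  assumes "0 < r"
  shows "Lipschitz_bump r {y. infdist y (orbit_of H x) < r} (orbit_bump H r x)"
  unfolding Lipschitz_bump_def
proof (intro conjI allI impI)
  let ?d = "\<lambda>y. infdist y (orbit_of H x)"
  show "0 \<le> orbit_bump H r x y" "orbit_bump H r x y \<le> 1" for y
    using assms infdist_nonneg[of y "orbit_of H x"] by (auto simp: orbit_bump_def)
  show "orbit_bump H r x y = 0" if "y \<notin> {y. ?d y < r}" for y
    using that assms by (simp add: orbit_bump_def field_simps)
  fix y z
  have "\<bar>orbit_bump H r x y - orbit_bump H r x z\<bar> \<le> \<bar>?d y / r - ?d z / r\<bar>"
    unfolding orbit_bump_def by linarith
  also have "\<dots> = \<bar>?d y - ?d z\<bar> / r"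
    using assms by (simp flip: diff_divide_distrib)
  also have "\<dots> \<le> dist y z / r"
    using assms by (intro divide_right_mono infdist_triangle_abs) auto
  finally show "\<bar>orbit_bump H r x y - orbit_bump H r x z\<bar> \<le> dist y z / r" .
qed

lemma orbit_bump_ge_half:
  assumes "x \<in> orbit_of H x" "y \<in> ball x (r / 2)" "0 < r"
  shows "1 / 2 \<le> orbit_bump H r x y"
proof -
  have "infdist y (orbit_of H x) \<le> r / 2"
    using infdist_le[OF assms(1), of y] assms(2) by (simp add: dist_commute)
  then have "infdist y (orbit_of H x) / r \<le> 1 / 2"
    using assms(3) by (simp add: field_simps)
  then show ?thesis unfolding orbit_bump_def by linarith
qed

lemma near_orbit_covered_by_unit_balls:
  fixes x :: "'a::metric_space"
  assumes "orbit_packing H x r \<le> enat K" "0 < r" "r \<le> 1 / 3" and x: "x \<in> orbit_of H x"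
  obtains A where "finite A" "card A \<le> K" "{y. infdist y (orbit_of H x) < r} \<subseteq> (\<Union>\<xi>\<in>A. ball \<xi> 1)"
proof -
  obtain A where A: "finite A" "card A \<le> K" "\<And>y. y \<in> orbit_of H x \<Longrightarrow> \<exists>\<xi>\<in>A. dist y \<xi> < 2 * r"
    using orbit_covered_by_packing[OF assms(1,2)] by blast
  have "\<exists>\<xi>\<in>A. dist \<xi> y < 1" if "infdist y (orbit_of H x) < r" for y
  proof -
    have "(INF z\<in>orbit_of H x. dist y z) < r"
      using that x by (metis empty_iff infdist_notempty)
    then obtain z where z: "z \<in> orbit_of H x" "dist y z < r"
      using x by (subst (asm) cINF_less_iff) auto
    obtain \<xi> where \<xi>: "\<xi> \<in> A" "dist z \<xi> < 2 * r" using A(3)[OF z(1)] by blast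
    have "dist \<xi> y < 1"
      using dist_triangle[of y \<xi> z] z \<xi> assms(3) by (simp add: dist_commute)
    with \<xi> show ?thesis by blast
  qed
  with A show ?thesis by (intro that[of A]) auto
qed

text \<open>Isometries are continuous, hence Borel, so pushing \<open>M = distr M M h\<close> forward by the inverse
  gives \<open>M\<close> again. This makes the abstract inverse in the group the inverse function.\<close>

lemma inv_in_Iso:
  assumes M: "sets M = sets borel" and "h \<in> Iso M"
  shows "inv_into UNIV h \<in> Iso M"
proof -
  have h: "bij h" "\<And>x y. dist (h x) (h y) = dist x y" "distr M M h = M"
    using assms(2) by (auto simp: Iso_def)
  have dist_inv: "dist (inv_into UNIV h x) (inv_into UNIV h y) = dist x y" for x y
    using h(2)[of "inv_into UNIV h x" "inv_into UNIV h y"] bij_is_surj[OF h(1)] by (simp add: surj_f_inv_f)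
  have meas: "f \<in> measurable M M" if "\<And>x y. dist (f x) (f y) = dist x y" for f :: "'a \<Rightarrow> 'a"
  proof -
    have "continuous_on UNIV f"
      unfolding continuous_on_iff using that by auto
    then have "f \<in> measurable borel borel" by (rule borel_measurable_continuous_onI)
    then show ?thesis using measurable_cong_sets[OF M M] by simp
  qed
  have "distr M M (inv_into UNIV h) = distr (distr M M h) M (inv_into UNIV h)" by (simp add: h(3))
  also have "\<dots> = distr M M (inv_into UNIV h \<circ> h)"
    using meas[OF dist_inv] meas[OF h(2)] by (rule distr_distr)
  also have "inv_into UNIV h \<circ> h = (\<lambda>x. x)"
    using bij_is_inj[OF h(1)] by (auto simp: fun_eq_iff)
  finally show ?thesis
    using dist_inv bij_imp_bij_inv[OF h(1)] by (simp add: Iso_def)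
qed

lemma group_of_isometries:
  assumes M: "sets M = sets borel" and "subgroup H (Iso_group M)"
  shows "id \<in> H" "\<And>h. h \<in> H \<Longrightarrow> h \<in> Iso M"
    "\<And>h k. h \<in> H \<Longrightarrow> k \<in> H \<Longrightarrow> h \<circ> k \<in> H"
    "\<And>h. h \<in> H \<Longrightarrow> \<exists>k\<in>H. h \<circ> k = id"
proof -
  interpret subgroup H "Iso_group M" by fact
  show "id \<in> H" using one_closed by (simp add: Iso_group_def)
  show Iso: "h \<in> Iso M" if "h \<in> H" for h using subset that by (auto simp: Iso_group_def)
  show "h \<circ> k \<in> H" if "h \<in> H" "k \<in> H" for h k
    using m_closed[OF that] by (simp add: Iso_group_def)
  show "\<exists>k\<in>H. h \<circ> k = id" if h: "h \<in> H" for h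
  proof
    have bij: "bij h" using Iso[OF h] by (simp add: Iso_def)
    show right: "h \<circ> inv_into UNIV h = id"
      using bij_is_surj[OF bij] by (simp add: surj_iff)
    have left: "inv_into UNIV h \<circ> h = id"
      using bij_is_inj[OF bij] by simp
    have "m_inv (Iso_group M) h = inv_into UNIV h"
      unfolding m_inv_def Iso_group_def
    proof (simp, rule the_equality)
      show "inv_into UNIV h \<in> Iso M \<and> h \<circ> inv_into UNIV h = id \<and> inv_into UNIV h \<circ> h = id"
        using inv_in_Iso[OF M Iso[OF h]] left right by simp
      show "k = inv_into UNIV h" if "k \<in> Iso M \<and> h \<circ> k = id \<and> k \<circ> h = id" for k
        using that left by (metis comp_assoc comp_id id_comp)
    qed
    then show "inv_into UNIV h \<in> H" using m_inv_closed[OF h] by simp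
  qed
qed

text \<open>An element \<open>h\<close> of the group permutes the orbit, so the distances of \<open>h y\<close> to the orbit are the
  distances of \<open>y\<close> to it in another order.\<close>

lemma orbit_bump_invariant:
  assumes M: "sets M = sets borel" and H: "subgroup H (Iso_group M)" and h: "h \<in> H"
  shows "orbit_bump H r x (h y) = orbit_bump H r x y"
proof -
  note H = group_of_isometries[OF M H]
  have iso: "dist (h a) (h b) = dist a b" for a b
    using H(2)[OF h] by (auto simp: Iso_def)
  have "h ` orbit_of H x = orbit_of H x"
  proof
    show "h ` orbit_of H x \<subseteq> orbit_of H x"
    proof
      fix z assume "z \<in> h ` orbit_of H x"
      then obtain g where g: "g \<in> H" "z = (h \<circ> g) x" by (auto simp: orbit_of_def)
      then show "z \<in> orbit_of H x"
        using H(3)[OF h g(1)] unfolding orbit_of_def by blast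
    qed
    show "orbit_of H x \<subseteq> h ` orbit_of H x"
    proof
      fix z assume "z \<in> orbit_of H x"
      then obtain g where g: "g \<in> H" "z = g x" by (auto simp: orbit_of_def)
      obtain k where k: "k \<in> H" "h \<circ> k = id" using H(4)[OF h] by blast
      have "z = h ((k \<circ> g) x)" using g k by (metis comp_apply id_apply)
      moreover have "(k \<circ> g) x \<in> orbit_of H x"
        using H(3)[OF k(1) g(1)] unfolding orbit_of_def by blast
      ultimately show "z \<in> h ` orbit_of H x" by (rule image_eqI)
    qed
  qed
  then have "(\<lambda>z. dist (h y) z) ` orbit_of H x = (\<lambda>z. dist y z) ` orbit_of H x"
    by (metis (mono_tags, lifting) image_cong image_image iso)
  then have "infdist (h y) (orbit_of H x) = infdist y (orbit_of H x)"
    by (simp add: infdist_def)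
  then show ?thesis by (simp add: orbit_bump_def)
qed

theorem theorem3p13:
  fixes M :: "'a::metric_space measure"
    and H :: "('a \<Rightarrow> 'a) set"
    and s p \<beta> q :: "'a \<Rightarrow> ennreal"
  assumes "metric_measure_space M"
    and "\<not> bounded (UNIV :: 'a set)"
    and "(SUP x. emeasure M (ball x 1)) < \<infinity>"
    and "\<forall>r\<in>{0<..<1}. 0 < (INF x. emeasure M (ball x r))"
    and "subgroup H (Iso_group M)"
    and "compactin compact_open_topology H"
    and "s \<in> bounded_exponents M"
    and "p \<in> bounded_exponents M"
    and "\<beta> \<in> bounded_exponents M"
    and "q \<in> exponents M"
    and "esssup M s < 1 \<and> essinf M q < \<infinity> \<or> esssup M s \<le> 1 \<and> essinf M q = \<infinity>"
    and "compact_embedding (invariant_part M H (M_space M s p q)) (M_norm M s p q)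
           (Lp_space M \<beta>) (Lp_norm M \<beta>) \<or>
         compact_embedding (invariant_part M H (N_space M s p q)) (N_norm M s p q)
           (Lp_space M \<beta>) (Lp_norm M \<beta>)"
  shows "\<forall>x\<^sub>0. \<forall>r\<in>{0<..<1/3}.
    ((\<lambda>R. INF x\<in>- ball x\<^sub>0 R. orbit_packing H x r) \<longlongrightarrow> \<infinity>) at_top"
proof (intro allI ballI)
  fix x\<^sub>0 :: 'a and r :: real
  assume "r \<in> {0<..<1/3}"
  then have r: "0 < r" "r \<le> 1 / 3" by auto
  have M: "sets M = sets borel" using assms(1) by (simp add: metric_measure_space_def)
  have bounded_P: "bounded {x. orbit_packing H x r \<le> enat K}" (is "bounded ?P") for K
  proof (rule ccontr)
    assume unbounded: "\<not> bounded ?P"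
    let ?u = "orbit_bump H r"
    let ?B = "(\<lambda>x y. ereal (?u x y)) ` ?P"
    let ?near = "\<lambda>x. {y. infdist y (orbit_of H x) < r}"
    have self: "x \<in> orbit_of H x" for x
      using group_of_isometries(1)[OF M assms(5)] by (auto simp: orbit_of_def intro!: exI[of _ id])
    obtain c where c: "0 \<le> c" "\<And>x. emeasure M (ball x 1) \<le> ennreal c"
    proof -
      obtain c where "0 \<le> c" "(SUP x. emeasure M (ball x 1)) = ennreal c"
        using assms(3) by (cases "SUP x. emeasure M (ball x 1)") auto
      then show thesis by (intro that[of c]) (auto intro: SUP_upper simp flip: \<open>_ = ennreal c\<close>)
    qed
    \<comment> \<open>At most \<open>K\<close> unit balls; the maximum only ensures \<open>1 \<le> V\<close>.\<close>
    define V where "V = max 1 (real K * c)"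
    have near_sets: "?near x \<in> sets M" for x
      unfolding M by (intro borel_open open_Collect_less continuous_intros)
    have near_measure: "emeasure M (?near x) \<le> ennreal V" if P: "x \<in> ?P" for x
    proof -
      have packing: "orbit_packing H x r \<le> enat K" using P by simp
      obtain A where A: "finite A" "card A \<le> K" "?near x \<subseteq> (\<Union>\<xi>\<in>A. ball \<xi> 1)"
        by (rule near_orbit_covered_by_unit_balls[OF packing r self])
      have "emeasure M (?near x) \<le> emeasure M (\<Union>\<xi>\<in>A. ball \<xi> 1)"
        using A by (intro emeasure_mono) (auto simp: M)
      also have "\<dots> \<le> (\<Sum>\<xi>\<in>A. emeasure M (ball \<xi> 1))"
        using A by (intro emeasure_subadditive_finite) (auto simp: M)
      also have "\<dots> \<le> (\<Sum>\<xi>\<in>A. ennreal c)"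
        by (intro sum_mono c)
      also have "\<dots> = ennreal (real (card A) * c)"
        using c(1) by (simp add: ennreal_mult ennreal_of_nat_eq_real_of_nat)
      also have "\<dots> \<le> ennreal V"
        using A(2) c(1) mult_right_mono[of "real (card A)" "real K" c]
        by (intro ennreal_leI) (simp add: V_def)
      finally show ?thesis .
    qed
    have bump: "Lipschitz_bump r (?near x) (?u x)" for x
      using orbit_bump_is_Lipschitz_bump[OF r(1)] .
    have "1 \<le> V" "r \<le> 1 / 2" using r by (auto simp: V_def)
    then obtain C where C: "C < \<infinity>"
      and bound: "\<forall>S u. S \<in> sets M \<and> emeasure M S \<le> ennreal V \<and> Lipschitz_bump r S u \<longrightarrow>
        (\<lambda>x. ereal (u x)) \<in> Lp_space M p \<and>
        M_norm M s p q (\<lambda>x. ereal (u x)) \<le> C \<and> N_norm M s p q (\<lambda>x. ereal (u x)) \<le> C"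
      using Lipschitz_bump_norm_bound[OF M r(1) _ _ assms(7,8,10,11)] by blast
    have norms: "u \<in> Lp_space M p \<and> M_norm M s p q u \<le> C \<and> N_norm M s p q u \<le> C"
      if "u \<in> ?B" for u
      using that bound near_sets near_measure bump by blast
    have invariant: "AE y in M. u (h y) = u y" if "u \<in> ?B" "h \<in> H" for u h
      using that orbit_bump_invariant[OF M assms(5)] by auto
    have "M_seminorm M s p q u < \<infinity>" "N_seminorm M s p q u < \<infinity>" if "u \<in> ?B" for u
    proof -
      have "M_norm M s p q u < \<infinity>" "N_norm M s p q u < \<infinity>"
        using norms[OF that] C by (auto intro: le_less_trans)
      then show "M_seminorm M s p q u < \<infinity>" "N_seminorm M s p q u < \<infinity>"
        by (auto simp: M_norm_def N_norm_def)
    qed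
    then have sub: "?B \<subseteq> invariant_part M H (M_space M s p q)"
      "?B \<subseteq> invariant_part M H (N_space M s p q)"
      using norms invariant unfolding invariant_part_def M_space_def N_space_def by blast+
    have "qnorm_bounded (M_norm M s p q) ?B" "qnorm_bounded (N_norm M s p q) ?B"
      unfolding qnorm_bounded_def using norms C by blast+
    then have tb: "qnorm_totally_bounded (Lp_space M \<beta>) (Lp_norm M \<beta>) ?B"
      using assms(12) sub unfolding compact_embedding_def by blast
    have "\<not> qnorm_totally_bounded (Lp_space M \<beta>) (Lp_norm M \<beta>) ?B"
    proof (rule escaping_bumps_not_totally_bounded[OF M assms(9) _ _ unbounded])
      show "0 < (INF x. emeasure M (ball x (r / 2)))"
        using assms(4) r by auto
      show "0 < r / 2" using r by simp
      show "1 / 2 \<le> ?u x y" if "y \<in> ball x (r / 2)" for x y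
        using orbit_bump_ge_half[OF self that r(1)] .
      show "bounded {y. ?u x y \<noteq> 0}" if P: "x \<in> ?P" for x
      proof -
        have packing: "orbit_packing H x r \<le> enat K" using P by simp
        obtain A where A: "finite A" "?near x \<subseteq> (\<Union>\<xi>\<in>A. ball \<xi> 1)"
          by (rule near_orbit_covered_by_unit_balls[OF packing r self])
        have "bounded (\<Union>\<xi>\<in>A. ball \<xi> 1)" using A(1) by (intro bounded_UN) auto
        moreover have "{y. ?u x y \<noteq> 0} \<subseteq> (\<Union>\<xi>\<in>A. ball \<xi> 1)"
          using bump[of x] A(2) unfolding Lipschitz_bump_def by blast
        ultimately show ?thesis by (rule bounded_subset)
      qed
    qed (rule Lipschitz_bump_measurable[OF bump r(1)])
    with tb show False by contradiction
  qed
  show "((\<lambda>R. INF x\<in>- ball x\<^sub>0 R. orbit_packing H x r) \<longlongrightarrow> \<infinity>) at_top"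
  proof (rule order_tendstoI)
    fix a :: enat assume "a < \<infinity>"
    then obtain K where K: "a = enat K" by (cases a) auto
    obtain R\<^sub>0 where R\<^sub>0: "\<And>x. orbit_packing H x r \<le> enat K \<Longrightarrow> dist x\<^sub>0 x \<le> R\<^sub>0"
      using bounded_P[of K] unfolding bounded_any_center[where a = x\<^sub>0] by auto
    show "\<forall>\<^sub>F R in at_top. a < (INF x\<in>- ball x\<^sub>0 R. orbit_packing H x r)"
      using eventually_gt_at_top[of R\<^sub>0]
    proof eventually_elim
      case (elim R)
      have "enat (Suc K) \<le> orbit_packing H x r" if "x \<in> - ball x\<^sub>0 R" for x
      proof -
        have "\<not> orbit_packing H x r \<le> enat K"
          using R\<^sub>0[of x] that elim by auto
        then show ?thesis by (metis Suc_ile_eq not_le)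
      qed
      then have "enat (Suc K) \<le> (INF x\<in>- ball x\<^sub>0 R. orbit_packing H x r)"
        by (rule INF_greatest)
      then show ?case unfolding K by (rule less_le_trans[rotated]) simp
    qed
  qed simp
qed

end
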